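(* Let $X$ be a paracompact Hausdorff space and let $\mathcal{C}$ be an open covering of $X$. Then the set $\mathrm{L}(\mathcal{C})$ of all $d\in\mathrm{CPM}(X)$ such that $\mathcal{C}$ has a (positive) Lebesgue number with respect to $d$ is open and dense in $(\mathrm{CPM}(X),\mathcal{D}_X)$.
   Context: A pseudometric on a set $X$ is a map $d\colon X\times X\to[0,\infty)$ with $d(x,x)=0$, $d(x,y)=d(y,x)$ and $d(x,y)\le d(x,z)+d(z,y)$ for all $x,y,z\in X$. For a topological space $X$, $\mathrm{CPM}(X)$ denotes the set of all pseudometrics $d$ on $X$ that are continuous as maps $X\times X\to[0,\infty)$. Define $\mathcal{D}_X\colon \mathrm{CPM}(X)^2\to[0,\infty]$ by $\mathcal{D}_X(d,e)=\sup_{x,y\in X}|d(x,y)-e(x,y)|$; although it may take the value $\infty$, it induces a topology on $\mathrm{CPM}(X)$ via open balls as for ordinary metrics, and $\mathrm{CPM}(X)$ carries this topology. For a pseudometric $d$ on $X$, $x\in X$ and $r\in(0,\infty)$, put $U(x,r;d)=\{p\in X\mid d(x,p)<r\}$. Given a covering $\mathcal{C}=\{C_i\}_{i\in I}$ of $X$, a number $r\in(0,\infty)$ is a Lebesgue number of $\mathcal{C}$ with respect to $d$ if for every $x\in X$ there exists $i\in I$ with $U(x,r;d)\subseteq C_i$. *)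

theory Defs
  imports "HOL-Analysis.Analysis"
begin

definition open_covering :: "'a topology \<Rightarrow> 'a set set \<Rightarrow> bool" where
  "open_covering X \<C> \<longleftrightarrow> (\<forall>C\<in>\<C>. openin X C) \<and> \<Union>\<C> = topspace X"

definition paracompact_space :: "'a topology \<Rightarrow> bool" where
  "paracompact_space X \<longleftrightarrow>
     (\<forall>\<C>. open_covering X \<C> \<longrightarrow>
        (\<exists>\<V>. open_covering X \<V> \<and> (\<forall>V\<in>\<V>. \<exists>C\<in>\<C>. V \<subseteq> C) \<and> locally_finite_in X \<V>))"

text \<open>Maps on \<open>S \<times> S\<close> are represented by functions on the ambient type that take the
  value \<open>undefined\<close> off \<open>S \<times> S\<close>, so that equality of functions is equality of maps on
  \<open>S \<times> S\<close>.\<close>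

definition pseudometric_on :: "'a set \<Rightarrow> ('a \<times> 'a \<Rightarrow> real) \<Rightarrow> bool" where
  "pseudometric_on S d \<longleftrightarrow>
     d \<in> (S \<times> S) \<rightarrow>\<^sub>E {0..} \<and>
     (\<forall>x\<in>S. d (x, x) = 0) \<and>
     (\<forall>x\<in>S. \<forall>y\<in>S. d (x, y) = d (y, x)) \<and>
     (\<forall>x\<in>S. \<forall>y\<in>S. \<forall>z\<in>S. d (x, y) \<le> d (x, z) + d (z, y))"

definition CPM :: "'a topology \<Rightarrow> ('a \<times> 'a \<Rightarrow> real) set" where
  "CPM X = {d. pseudometric_on (topspace X) d \<and>
               continuous_map (prod_topology X X) (top_of_set {0..}) d}"

text \<open>In \<^typ>\<open>ennreal\<close> the supremum always exists, and it is \<open>0\<close> when \<open>X\<close> is empty.\<close>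

definition sup_dist ::
    "'a topology \<Rightarrow> ('a \<times> 'a \<Rightarrow> real) \<Rightarrow> ('a \<times> 'a \<Rightarrow> real) \<Rightarrow> ennreal" where
  "sup_dist X d e =
     (SUP (x, y) \<in> topspace X \<times> topspace X. ennreal \<bar>d (x, y) - e (x, y)\<bar>)"

definition CPM_topology :: "'a topology \<Rightarrow> ('a \<times> 'a \<Rightarrow> real) topology" where
  "CPM_topology X = topology (\<lambda>U. U \<subseteq> CPM X \<and>
     (\<forall>d\<in>U. \<exists>r::real. 0 < r \<and> {e \<in> CPM X. sup_dist X d e < ennreal r} \<subseteq> U))"

lemma openin_CPM_topology:
  "openin (CPM_topology X) U \<longleftrightarrow> U \<subseteq> CPM X \<and>
     (\<forall>d\<in>U. \<exists>r::real. 0 < r \<and> {e \<in> CPM X. sup_dist X d e < ennreal r} \<subseteq> U)"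
proof -
  have "istopology (\<lambda>U. U \<subseteq> CPM X \<and>
     (\<forall>d\<in>U. \<exists>r::real. 0 < r \<and> {e \<in> CPM X. sup_dist X d e < ennreal r} \<subseteq> U))"
    (is "istopology ?P")
    unfolding istopology_def
  proof (intro conjI allI impI)
    fix S T assume S: "?P S" and T: "?P T"
    show "S \<inter> T \<subseteq> CPM X" using S by blast
    show "\<forall>d\<in>S \<inter> T. \<exists>r::real. 0 < r \<and> {e \<in> CPM X. sup_dist X d e < ennreal r} \<subseteq> S \<inter> T"
    proof
      fix d assume "d \<in> S \<inter> T"
      then obtain r s :: real
        where "0 < r" "{e \<in> CPM X. sup_dist X d e < ennreal r} \<subseteq> S"
          and "0 < s" "{e \<in> CPM X. sup_dist X d e < ennreal s} \<subseteq> T"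
        using S T by blast
      moreover have "a < ennreal r" "a < ennreal s" if "a < ennreal (min r s)" for a
        by (rule order_less_le_trans[OF that], simp add: ennreal_leI)+
      ultimately have "{e \<in> CPM X. sup_dist X d e < ennreal (min r s)} \<subseteq> S \<inter> T"
        by blast
      then show "\<exists>r::real. 0 < r \<and> {e \<in> CPM X. sup_dist X d e < ennreal r} \<subseteq> S \<inter> T"
        using \<open>0 < r\<close> \<open>0 < s\<close> by (intro exI[of _ "min r s"]) auto
    qed
  next
    fix \<K> assume K: "\<forall>K\<in>\<K>. ?P K"
    then show "\<Union>\<K> \<subseteq> CPM X" by blast
    show "\<forall>d\<in>\<Union>\<K>. \<exists>r::real. 0 < r \<and> {e \<in> CPM X. sup_dist X d e < ennreal r} \<subseteq> \<Union>\<K>"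
      using K by (meson Union_iff Union_upper order_trans)
  qed
  then show ?thesis
    by (simp add: CPM_topology_def topology_inverse')
qed

lemma topspace_CPM_topology: "topspace (CPM_topology X) = CPM X"
proof
  show "topspace (CPM_topology X) \<subseteq> CPM X"
    using openin_CPM_topology openin_topspace by blast
  have "openin (CPM_topology X) (CPM X)"
    unfolding openin_CPM_topology using zero_less_one by blast
  then show "CPM X \<subseteq> topspace (CPM_topology X)"
    by (rule openin_subset)
qed

definition pm_ball :: "'a set \<Rightarrow> ('a \<times> 'a \<Rightarrow> real) \<Rightarrow> 'a \<Rightarrow> real \<Rightarrow> 'a set" where
  "pm_ball S d x r = {p \<in> S. d (x, p) < r}"

definition Lebesgue_number ::
    "'a set \<Rightarrow> 'a set set \<Rightarrow> ('a \<times> 'a \<Rightarrow> real) \<Rightarrow> real \<Rightarrow> bool" where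
  "Lebesgue_number S \<C> d r \<longleftrightarrow> 0 < r \<and> (\<forall>x\<in>S. \<exists>C\<in>\<C>. pm_ball S d x r \<subseteq> C)"

definition Lebesgue_CPM :: "'a topology \<Rightarrow> 'a set set \<Rightarrow> ('a \<times> 'a \<Rightarrow> real) set" where
  "Lebesgue_CPM X \<C> = {d \<in> CPM X. \<exists>r. Lebesgue_number (topspace X) \<C> d r}"

end

theory Submission
  imports Defs
begin

text \<open>
  Openness is elementary: if \<open>r\<close> is a Lebesgue number for \<open>d\<close> and \<open>e\<close> is uniformly closer than
  \<open>r / 2\<close> to \<open>d\<close>, then every \<open>e\<close>-ball of radius \<open>r / 2\<close> lies in the \<open>d\<close>-ball of radius \<open>r\<close> about
  the same point, so \<open>r / 2\<close> is a Lebesgue number for \<open>e\<close> (\<open>openin_Lebesgue_CPM\<close>).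

  For density it suffices to have a single continuous pseudometric \<open>\<rho> \<le> 1\<close> for which the
  covering has a Lebesgue number. Indeed \<open>d + c * \<rho>\<close> is within \<open>c\<close> of \<open>d\<close>, and since it dominates
  \<open>c * \<rho>\<close> its small balls are contained in balls of \<open>\<rho>\<close>, so it inherits a Lebesgue number
  (\<open>Lebesgue_CPM_add_scaled\<close>).

  Such a \<open>\<rho>\<close> is built in \<open>exists_bounded_CPM_Lebesgue\<close>. Take a locally finite open refinement
  \<open>\<V>\<close> of the covering, shrink its members to closed sets \<open>F V \<subseteq> V\<close> that still cover the
  space, and choose Urysohn functions \<open>g V\<close> equal to \<open>1\<close> on \<open>F V\<close> and to \<open>0\<close> off \<open>V\<close>. Put
  \<open>\<rho> (x, y) = (SUP V\<in>\<V>. \<bar>g V x - g V y\<bar>)\<close>. Near any point only finitely many \<open>g V\<close> are nonzero,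
  which makes \<open>\<rho>\<close> continuous. Every \<open>x\<close> lies in some \<open>F V\<close>, and a point \<open>p\<close> outside \<open>V\<close> has
  \<open>\<rho> (x, p) \<ge> \<bar>1 - 0\<bar>\<close>, so the unit ball about \<open>x\<close> stays in \<open>V\<close>. It is the value \<open>1\<close> on a closed
  covering that makes the radius uniform; the functions of an arbitrary partition of unity
  may all be small at a point.

  The shrinking and the Urysohn functions need regularity and normality, which follow from
  paracompactness and the Hausdorff property by applying \<open>paracompact_separation\<close> twice.
\<close>

section \<open>Separation and shrinking in paracompact spaces\<close>

lemma paracompact_refinement:
  assumes "paracompact_space X" and "open_covering X \<C>"
  obtains \<V> where "open_covering X \<V>" "\<And>V. V \<in> \<V> \<Longrightarrow> \<exists>C\<in>\<C>. V \<subseteq> C"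
    "locally_finite_in X \<V>"
  using assms unfolding paracompact_space_def by metis

text \<open>
  Separating each point of \<open>A\<close> from \<open>B\<close> separates all of \<open>A\<close> from \<open>B\<close>: the separating
  neighbourhoods together with the complement of \<open>A\<close> have a locally finite refinement, and the
  closure of a locally finite union is the union of the closures, each of which misses \<open>B\<close>.
\<close>

lemma paracompact_separation:
  assumes para: "paracompact_space X" and A: "closedin X A"
    and sep: "\<And>a. a \<in> A \<Longrightarrow> \<exists>U. openin X U \<and> a \<in> U \<and> disjnt B (X closure_of U)"
  shows "\<exists>U. openin X U \<and> A \<subseteq> U \<and> disjnt B (X closure_of U)"
proof -
  obtain U where U: "\<And>a. a \<in> A \<Longrightarrow> openin X (U a) \<and> a \<in> U a \<and> disjnt B (X closure_of U a)"
    using sep by metis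
  have "open_covering X (insert (topspace X - A) (U ` A))" (is "open_covering X ?\<O>")
    unfolding open_covering_def
  proof
    show "\<forall>C\<in>insert (topspace X - A) (U ` A). openin X C"
      using U A by auto
    have "U a \<subseteq> topspace X" if "a \<in> A" for a
      using U[OF that] openin_subset by blast
    moreover have "A \<subseteq> (\<Union>a\<in>A. U a)"
      using U by blast
    ultimately show "\<Union> (insert (topspace X - A) (U ` A)) = topspace X"
      by auto
  qed
  then obtain \<V> where \<V>: "open_covering X \<V>"
      "\<And>V. V \<in> \<V> \<Longrightarrow> \<exists>C\<in>?\<O>. V \<subseteq> C"
      "locally_finite_in X \<V>"
    using paracompact_refinement[OF para] by metis
  \<comment> \<open>A member that meets \<open>A\<close> cannot refine the complement of \<open>A\<close>, so it lies in some \<open>U a\<close>.\<close>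
  define \<W> where "\<W> = {V \<in> \<V>. V \<inter> A \<noteq> {}}"
  have "openin X (\<Union>\<W>)"
    using \<V>(1) unfolding open_covering_def \<W>_def by blast
  moreover have "A \<subseteq> \<Union>\<W>"
    using \<V>(1) closedin_subset[OF A] unfolding open_covering_def \<W>_def by blast
  moreover have "disjnt B (X closure_of (\<Union>\<W>))"
  proof -
    have lf: "locally_finite_in X \<W>"
      using \<V>(3) by (rule locally_finite_in_subset) (auto simp: \<W>_def)
    have "disjnt B (X closure_of W)" if W: "W \<in> \<W>" for W
    proof -
      obtain a where "a \<in> A" "W \<subseteq> U a"
        using \<V>(2)[of W] W unfolding \<W>_def by blast
      with U[of a] closure_of_mono[of W "U a" X] show ?thesis
        unfolding disjnt_def by blast
    qed
    then show ?thesis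
      unfolding closure_of_locally_finite_Union[OF lf] disjnt_def by blast
  qed
  ultimately show ?thesis by blast
qed

lemma paracompact_Hausdorff_imp_regular_space:
  assumes para: "paracompact_space X" and haus: "Hausdorff_space X"
  shows "regular_space X"
  unfolding regular_space_def
proof (intro allI impI)
  fix C a assume Ca: "closedin X C \<and> a \<in> topspace X - C"
  have "\<exists>U. openin X U \<and> c \<in> U \<and> disjnt {a} (X closure_of U)" if "c \<in> C" for c
  proof -
    have "c \<in> topspace X" "a \<in> topspace X" "c \<noteq> a"
      using Ca that closedin_subset[of X C] by auto
    then obtain U V where UV: "openin X U" "openin X V" "c \<in> U" "a \<in> V" "disjnt U V"
      using haus unfolding Hausdorff_space_def by metis
    then have "a \<notin> X closure_of U"
      unfolding in_closure_of disjnt_iff by blast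
    with UV show ?thesis by auto
  qed
  then obtain U where "openin X U" "C \<subseteq> U" "disjnt {a} (X closure_of U)"
    using paracompact_separation[OF para, of C "{a}"] Ca by blast
  then show "\<exists>U V. openin X U \<and> openin X V \<and> a \<in> U \<and> C \<subseteq> V \<and> disjnt U V"
    using Ca closure_of_subset[of U X] openin_subset[of X U]
    by (intro exI[of _ "topspace X - X closure_of U"] exI[of _ U]) (auto simp: disjnt_iff)
qed

lemma paracompact_regular_imp_normal_space:
  assumes "paracompact_space X" and "regular_space X"
  shows "normal_space X"
  unfolding normal_space
proof (intro allI impI)
  fix S T assume ST: "closedin X S \<and> closedin X T \<and> disjnt S T"
  show "\<exists>U. openin X U \<and> S \<subseteq> U \<and> disjnt T (X closure_of U)"
  proof (rule paracompact_separation[OF assms(1)])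
    show "\<exists>U. openin X U \<and> a \<in> U \<and> disjnt T (X closure_of U)" if "a \<in> S" for a
      using assms(2) ST that closedin_subset[of X S] unfolding regular_space disjnt_iff by blast
  qed (use ST in blast)
qed

text \<open>
  By regularity the open sets whose closure lies in a member of \<open>\<V>\<close> cover the space. In a
  locally finite refinement \<open>\<W>\<close> of these, assign to each \<open>W\<close> one \<open>V \<in> \<V>\<close> containing its closure;
  \<open>F V\<close> is the union of the closures assigned to \<open>V\<close>, closed by local finiteness. Indexing by \<open>\<V>\<close>
  instead of \<open>\<W>\<close> matters when \<open>\<V>\<close> is locally finite: then so are the supports of functions that
  vanish off \<open>V\<close>, whereas one \<open>V\<close> may serve infinitely many \<open>W\<close>.
\<close>

lemma paracompact_regular_shrinking:
  assumes para: "paracompact_space X" and reg: "regular_space X" and cov: "open_covering X \<V>"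
  obtains F where "\<And>V. V \<in> \<V> \<Longrightarrow> closedin X (F V)" "\<And>V. V \<in> \<V> \<Longrightarrow> F V \<subseteq> V"
    "topspace X \<subseteq> (\<Union>V\<in>\<V>. F V)"
proof -
  define \<O> where "\<O> = {U. openin X U \<and> (\<exists>V\<in>\<V>. X closure_of U \<subseteq> V)}"
  have "topspace X \<subseteq> \<Union>\<O>"
  proof
    fix x assume x: "x \<in> topspace X"
    then obtain V where V: "V \<in> \<V>" "x \<in> V" "openin X V"
      using cov unfolding open_covering_def by blast
    then obtain U where U: "openin X U" "x \<in> U" "disjnt (topspace X - V) (X closure_of U)"
      using reg x unfolding regular_space by (metis DiffD2 DiffI closedin_diff closedin_topspace)
    then have "X closure_of U \<subseteq> V"
      using closure_of_subset_topspace[of X U] unfolding disjnt_def by blast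
    then show "x \<in> \<Union>\<O>" using U V unfolding \<O>_def by blast
  qed
  then have "open_covering X \<O>"
    using openin_subset[of X] unfolding open_covering_def \<O>_def by blast
  then obtain \<W> where W: "open_covering X \<W>" "\<And>W. W \<in> \<W> \<Longrightarrow> \<exists>U\<in>\<O>. W \<subseteq> U"
      "locally_finite_in X \<W>"
    using paracompact_refinement[OF para] by metis
  have "\<exists>V\<in>\<V>. X closure_of W \<subseteq> V" if w: "W \<in> \<W>" for W
  proof -
    obtain U V where "W \<subseteq> U" "V \<in> \<V>" "X closure_of U \<subseteq> V"
      using W(2)[OF w] unfolding \<O>_def by blast
    with closure_of_mono[of W U X] show ?thesis by blast
  qed
  then obtain p where p: "\<And>W. W \<in> \<W> \<Longrightarrow> p W \<in> \<V> \<and> X closure_of W \<subseteq> p W"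
    by metis
  define F where "F V = (\<Union>W\<in>{W \<in> \<W>. p W = V}. X closure_of W)" for V
  show thesis
  proof
    show "closedin X (F V)" for V
      unfolding F_def
      by (rule closedin_Union_locally_finite_closure, rule locally_finite_in_subset[OF W(3)]) auto
    show "F V \<subseteq> V" for V
      unfolding F_def using p by blast
    show "topspace X \<subseteq> (\<Union>V\<in>\<V>. F V)"
    proof
      fix x assume x: "x \<in> topspace X"
      then obtain w where w: "w \<in> \<W>" "x \<in> w"
        using W(1) unfolding open_covering_def by blast
      then have "x \<in> X closure_of w"
        using x unfolding in_closure_of by blast
      then show "x \<in> (\<Union>V\<in>\<V>. F V)"
        using w p unfolding F_def by blast
    qed
  qed
qed

section \<open>Continuous pseudometrics\<close>

text \<open>
  By the triangle inequality \<open>\<bar>d (x, y) - d (u, v)\<bar> \<le> d (x, u) + d (y, v)\<close>, so joint continuity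
  only has to be tested on the diagonal.
\<close>

lemma CPM_I:
  assumes pm: "pseudometric_on (topspace X) d"
    and near: "\<And>x \<epsilon>. \<lbrakk>x \<in> topspace X; 0 < \<epsilon>\<rbrakk> \<Longrightarrow>
      \<exists>U. openin X U \<and> x \<in> U \<and> (\<forall>y\<in>U. d (x, y) < \<epsilon>)"
  shows "d \<in> CPM X"
proof -
  have sym: "d (x, y) = d (y, x)" and tri: "d (x, y) \<le> d (x, z) + d (z, y)"
    if "x \<in> topspace X" "y \<in> topspace X" "z \<in> topspace X" for x y z
    using pm that unfolding pseudometric_on_def by blast+
  have "continuous_map (prod_topology X X) Met_TC.mtopology d"
    unfolding Met_TC.continuous_map_to_metric
  proof (intro ballI allI impI)
    fix p and \<epsilon> :: real
    assume "p \<in> topspace (prod_topology X X)" and \<epsilon>: "0 < \<epsilon>"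
    then obtain x y where p: "p = (x, y)" and xy: "x \<in> topspace X" "y \<in> topspace X"
      by auto
    obtain U V where U: "openin X U" "x \<in> U" "\<And>z. z \<in> U \<Longrightarrow> d (x, z) < \<epsilon> / 2"
      and V: "openin X V" "y \<in> V" "\<And>z. z \<in> V \<Longrightarrow> d (y, z) < \<epsilon> / 2"
      using near[OF xy(1), of "\<epsilon> / 2"] near[OF xy(2), of "\<epsilon> / 2"] \<epsilon> by auto
    have "dist (d (x, y)) (d (u, v)) < \<epsilon>" if uv: "u \<in> U" "v \<in> V" for u v
    proof -
      have top: "u \<in> topspace X" "v \<in> topspace X"
        using uv U(1) V(1) openin_subset by blast+
      have "d (x, y) \<le> d (x, u) + (d (u, v) + d (v, y))"
        using tri[of x y u] tri[of u y v] xy top by linarith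
      moreover have "d (u, v) \<le> d (u, x) + (d (x, y) + d (y, v))"
        using tri[of u v x] tri[of x v y] xy top by linarith
      moreover have "d (u, x) = d (x, u)" "d (v, y) = d (y, v)"
        using sym xy top by blast+
      ultimately show ?thesis
        using U(3)[OF uv(1)] V(3)[OF uv(2)] by (simp add: dist_real_def)
    qed
    then show "\<exists>U. openin (prod_topology X X) U \<and> p \<in> U \<and> (\<forall>q\<in>U. d q \<in> Met_TC.mball (d p) \<epsilon>)"
      using U(1,2) V(1,2) by (intro exI[of _ "U \<times> V"]) (auto simp: p openin_prod_Times_iff)
  qed
  moreover have "d \<in> topspace X \<times> topspace X \<rightarrow> {0..}"
    using pm unfolding pseudometric_on_def PiE_def by blast
  ultimately show ?thesis
    using pm unfolding CPM_def by (auto simp: continuous_map_in_subtopology)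
qed

lemma CPM_add_scaled:
  assumes d: "d \<in> CPM X" and \<rho>: "\<rho> \<in> CPM X" and c: "0 \<le> c"
  shows "restrict (\<lambda>p. d p + c * \<rho> p) (topspace X \<times> topspace X) \<in> CPM X" (is "?e \<in> _")
proof -
  let ?S = "topspace X"
  have pm: "pseudometric_on ?S d" "pseudometric_on ?S \<rho>"
    and cm: "continuous_map (prod_topology X X) euclideanreal d"
      "continuous_map (prod_topology X X) euclideanreal \<rho>"
    using d \<rho> unfolding CPM_def continuous_map_in_subtopology by auto
  have nn: "0 \<le> d (x, y)" "0 \<le> \<rho> (x, y)" if "x \<in> ?S" "y \<in> ?S" for x y
    using pm that unfolding pseudometric_on_def PiE_def Pi_def by auto
  have "d (x, y) + c * \<rho> (x, y) \<le> d (x, z) + c * \<rho> (x, z) + (d (z, y) + c * \<rho> (z, y))"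
    if "x \<in> ?S" "y \<in> ?S" "z \<in> ?S" for x y z
  proof -
    have "d (x, y) \<le> d (x, z) + d (z, y)" "\<rho> (x, y) \<le> \<rho> (x, z) + \<rho> (z, y)"
      using pm that unfolding pseudometric_on_def by blast+
    with mult_left_mono[OF this(2) c] show ?thesis
      by (simp add: algebra_simps)
  qed
  moreover have "d (x, y) + c * \<rho> (x, y) = d (y, x) + c * \<rho> (y, x)"
    if "x \<in> ?S" "y \<in> ?S" for x y
    using pm that unfolding pseudometric_on_def by metis
  ultimately have "pseudometric_on ?S ?e"
    using pm nn c unfolding pseudometric_on_def by auto
  moreover have "continuous_map (prod_topology X X) euclideanreal ?e"
    by (rule continuous_map_eq[of _ _ "\<lambda>p. d p + c * \<rho> p"])
      (auto intro!: continuous_intros cm)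
  ultimately show ?thesis
    unfolding CPM_def pseudometric_on_def PiE_def continuous_map_in_subtopology by auto
qed

lemma sup_dist_le:
  assumes "\<And>x y. \<lbrakk>x \<in> topspace X; y \<in> topspace X\<rbrakk> \<Longrightarrow> \<bar>d (x, y) - e (x, y)\<bar> \<le> c"
  shows "sup_dist X d e \<le> ennreal c"
  unfolding sup_dist_def using assms by (auto intro!: SUP_least ennreal_leI)

lemma sup_dist_lessD:
  assumes "sup_dist X d e < ennreal r" and "x \<in> topspace X" and "y \<in> topspace X"
  shows "\<bar>d (x, y) - e (x, y)\<bar> < r"
proof -
  have "ennreal \<bar>d (x, y) - e (x, y)\<bar> \<le> sup_dist X d e"
    unfolding sup_dist_def using assms(2,3) by (auto intro!: SUP_upper2[of "(x, y)"])
  with assms(1) show ?thesis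
    by (metis abs_ge_zero ennreal_less_iff order_le_less_trans)
qed

section \<open>A bounded pseudometric with a given Lebesgue covering\<close>

lemma exists_bounded_CPM_Lebesgue:
  assumes para: "paracompact_space X" and haus: "Hausdorff_space X"
    and cov: "open_covering X \<C>"
  obtains \<rho> where "\<rho> \<in> CPM X" "\<And>x y. \<lbrakk>x \<in> topspace X; y \<in> topspace X\<rbrakk> \<Longrightarrow> \<rho> (x, y) \<le> 1"
    "Lebesgue_number (topspace X) \<C> \<rho> 1"
proof -
  let ?S = "topspace X"
  have reg: "regular_space X"
    using para haus by (rule paracompact_Hausdorff_imp_regular_space)
  have norm: "normal_space X"
    using para reg by (rule paracompact_regular_imp_normal_space)
  obtain \<V> where \<V>: "open_covering X \<V>" "\<And>V. V \<in> \<V> \<Longrightarrow> \<exists>C\<in>\<C>. V \<subseteq> C"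
      "locally_finite_in X \<V>"
    using paracompact_refinement[OF para cov] by metis
  obtain F where F: "\<And>V. V \<in> \<V> \<Longrightarrow> closedin X (F V)" "\<And>V. V \<in> \<V> \<Longrightarrow> F V \<subseteq> V"
    "?S \<subseteq> (\<Union>V\<in>\<V>. F V)"
    using paracompact_regular_shrinking[OF para reg \<V>(1)] by metis
  have "\<exists>g. continuous_map X (top_of_set {0..1::real}) g \<and> g ` (?S - V) \<subseteq> {0} \<and> g ` F V \<subseteq> {1}"
    if V: "V \<in> \<V>" for V
  proof -
    have "closedin X (?S - V)" "closedin X (F V)" "disjnt (?S - V) (F V)"
      using V \<V>(1) F(1,2)[OF V] unfolding open_covering_def disjnt_def by auto
    from Urysohn_lemma[OF norm this zero_le_one] show ?thesis by metis
  qed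
  then obtain g :: "'a set \<Rightarrow> 'a \<Rightarrow> real" where g:
      "\<And>V. V \<in> \<V> \<Longrightarrow> continuous_map X (top_of_set {0..1}) (g V)"
      "\<And>V. V \<in> \<V> \<Longrightarrow> g V ` (?S - V) \<subseteq> {0}"
      "\<And>V. V \<in> \<V> \<Longrightarrow> g V ` F V \<subseteq> {1}"
    by metis
  have g01: "0 \<le> g V x" "g V x \<le> 1" if "V \<in> \<V>" "x \<in> ?S" for V x
    using g(1)[OF that(1)] that(2) unfolding continuous_map_in_subtopology by auto
  \<comment> \<open>Bounds on a supremum of reals require a nonempty index set.\<close>
  have ne: "\<V> \<noteq> {}" if "x \<in> ?S" for x
    using that \<V>(1) unfolding open_covering_def by auto
  define \<rho> where
    "\<rho> = restrict (\<lambda>(x, y). SUP V\<in>\<V>. \<bar>g V x - g V y\<bar>) (?S \<times> ?S)"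
  have diff_le: "\<bar>g V x - g V y\<bar> \<le> \<rho> (x, y)" if "V \<in> \<V>" "x \<in> ?S" "y \<in> ?S" for V x y
  proof -
    have "bdd_above ((\<lambda>V. \<bar>g V x - g V y\<bar>) ` \<V>)"
    proof (rule bdd_aboveI2)
      show "\<bar>g V x - g V y\<bar> \<le> 1" if "V \<in> \<V>" for V
        using g01[OF that \<open>x \<in> ?S\<close>] g01[OF that \<open>y \<in> ?S\<close>] by linarith
    qed
    then show ?thesis
      using that by (auto simp: \<rho>_def intro: cSUP_upper)
  qed
  have \<rho>_le: "\<rho> (x, y) \<le> c"
    if "x \<in> ?S" "y \<in> ?S" "\<And>V. V \<in> \<V> \<Longrightarrow> \<bar>g V x - g V y\<bar> \<le> c" for x y c
    using that ne[OF that(1)] by (auto simp: \<rho>_def intro!: cSUP_least)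
  have \<rho>_nonneg: "0 \<le> \<rho> (x, y)" if xy: "x \<in> ?S" "y \<in> ?S" for x y
  proof -
    obtain V where "V \<in> \<V>" using ne[OF xy(1)] by blast
    then show ?thesis using diff_le[OF _ xy] abs_ge_zero order_trans by blast
  qed
  have tri: "\<rho> (x, y) \<le> \<rho> (x, z) + \<rho> (z, y)" if "x \<in> ?S" "y \<in> ?S" "z \<in> ?S" for x y z
  proof (rule \<rho>_le)
    show "\<bar>g V x - g V y\<bar> \<le> \<rho> (x, z) + \<rho> (z, y)" if "V \<in> \<V>" for V
      using diff_le[of V x z] diff_le[of V z y] that \<open>x \<in> ?S\<close> \<open>y \<in> ?S\<close> \<open>z \<in> ?S\<close> by linarith
  qed (use that in auto)
  have pm: "pseudometric_on ?S \<rho>"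
    unfolding pseudometric_on_def
  proof (intro conjI ballI)
    show "\<rho> \<in> ?S \<times> ?S \<rightarrow>\<^sub>E {0..}"
      using \<rho>_nonneg by (intro PiE_I) (auto simp: \<rho>_def)
    show "\<rho> (x, x) = 0" if "x \<in> ?S" for x
      using \<rho>_le[of x x 0] \<rho>_nonneg[of x x] that by force
    show "\<rho> (x, y) = \<rho> (y, x)" if "x \<in> ?S" "y \<in> ?S" for x y
      using that by (simp add: \<rho>_def abs_minus_commute)
    show "\<rho> (x, y) \<le> \<rho> (x, z) + \<rho> (z, y)" if "x \<in> ?S" "y \<in> ?S" "z \<in> ?S" for x y z
      using tri that .
  qed
  show thesis
  proof
    show "\<rho> \<in> CPM X"
    proof (rule CPM_I[OF pm])
      fix x and \<epsilon> :: real assume x: "x \<in> ?S" and \<epsilon>: "0 < \<epsilon>"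
      obtain N where N: "openin X N" "x \<in> N" "finite {V \<in> \<V>. V \<inter> N \<noteq> {}}"
        using \<V>(3) x unfolding locally_finite_in_def by blast
      define \<F> where "\<F> = {V \<in> \<V>. V \<inter> N \<noteq> {}}"
      define P where "P V = {y \<in> ?S. g V y \<in> ball (g V x) (\<epsilon> / 2)}" for V
      have P: "openin X (P V)" if "V \<in> \<F>" for V
        unfolding P_def using g(1)[of V] that
        by (intro openin_continuous_map_preimage[of X euclideanreal])
          (auto simp: \<F>_def continuous_map_in_subtopology)
      have "openin X (N \<inter> (\<Inter>V\<in>\<F>. P V))"
      \<comment> \<open>The intersection over an empty \<open>\<F>\<close> is \<^const>\<open>UNIV\<close>, which need not be open in \<open>X\<close>.\<close>
      proof (cases "\<F> = {}")
        case True
        with N(1) show ?thesis by simp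
      next
        case False
        have "openin X (\<Inter>V\<in>\<F>. P V)"
          using N(3) False P unfolding \<F>_def[symmetric] by (intro openin_Inter) auto
        with N(1) show ?thesis by (rule openin_Int)
      qed
      moreover have "x \<in> N \<inter> (\<Inter>V\<in>\<F>. P V)"
        using N(2) x \<epsilon> by (auto simp: P_def)
      moreover have "\<rho> (x, y) < \<epsilon>" if y: "y \<in> N \<inter> (\<Inter>V\<in>\<F>. P V)" for y
      proof -
        have yS: "y \<in> ?S" using y N(1) openin_subset by blast
        have "\<rho> (x, y) \<le> \<epsilon> / 2"
        proof (rule \<rho>_le[OF x yS])
          fix V assume V: "V \<in> \<V>"
          show "\<bar>g V x - g V y\<bar> \<le> \<epsilon> / 2"
          \<comment> \<open>Members that miss \<open>N\<close> contribute \<open>0\<close>; the others are controlled by \<open>P V\<close>.\<close>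
          proof (cases "V \<in> \<F>")
            case True
            with y have "y \<in> P V" by blast
            then show ?thesis by (simp add: P_def dist_real_def)
          next
            case False
            with V N(2) y have "x \<notin> V" "y \<notin> V" unfolding \<F>_def by blast+
            then have "g V x = 0" "g V y = 0"
              using g(2)[OF V] x yS by auto
            with \<epsilon> show ?thesis by simp
          qed
        qed
        with \<epsilon> show ?thesis by linarith
      qed
      ultimately show "\<exists>U. openin X U \<and> x \<in> U \<and> (\<forall>y\<in>U. \<rho> (x, y) < \<epsilon>)"
        by blast
    qed
    show "\<rho> (x, y) \<le> 1" if "x \<in> ?S" "y \<in> ?S" for x y
    proof (rule \<rho>_le[OF that])
      show "\<bar>g V x - g V y\<bar> \<le> 1" if "V \<in> \<V>" for V
        using g01[OF that \<open>x \<in> ?S\<close>] g01[OF that \<open>y \<in> ?S\<close>] by linarith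
    qed
    show "Lebesgue_number ?S \<C> \<rho> 1"
      unfolding Lebesgue_number_def
    proof (intro conjI ballI)
      fix x assume x: "x \<in> ?S"
      then obtain V where V: "V \<in> \<V>" "x \<in> F V" using F(3) by blast
      obtain C where C: "C \<in> \<C>" "V \<subseteq> C" using \<V>(2) V(1) by blast
      have "p \<in> V" if p: "p \<in> ?S" "\<rho> (x, p) < 1" for p
      proof (rule ccontr)
        assume "p \<notin> V"
        then have "g V x = 1" "g V p = 0" using g(2,3)[OF V(1)] V(2) p by auto
        with diff_le[OF V(1) x p(1)] p(2) show False by simp
      qed
      with C show "\<exists>C\<in>\<C>. pm_ball ?S \<rho> x 1 \<subseteq> C"
        unfolding pm_ball_def by blast
    qed simp
  qed
qed

section \<open>The Lebesgue property is open and dense\<close>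

lemma openin_Lebesgue_CPM: "openin (CPM_topology X) (Lebesgue_CPM X \<C>)"
  unfolding openin_CPM_topology
proof (intro conjI ballI)
  show "Lebesgue_CPM X \<C> \<subseteq> CPM X"
    unfolding Lebesgue_CPM_def by blast
  fix d assume "d \<in> Lebesgue_CPM X \<C>"
  then obtain r where r: "0 < r" "\<And>x. x \<in> topspace X \<Longrightarrow> \<exists>C\<in>\<C>. pm_ball (topspace X) d x r \<subseteq> C"
    unfolding Lebesgue_CPM_def Lebesgue_number_def by blast
  have "Lebesgue_number (topspace X) \<C> e (r / 2)" if e: "sup_dist X d e < ennreal (r / 2)" for e
    unfolding Lebesgue_number_def
  proof (intro conjI ballI)
    fix x assume x: "x \<in> topspace X"
    have "d (x, p) < r" if "p \<in> topspace X" "e (x, p) < r / 2" for p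
      using sup_dist_lessD[OF e x that(1)] that(2) by linarith
    then have "pm_ball (topspace X) e x (r / 2) \<subseteq> pm_ball (topspace X) d x r"
      unfolding pm_ball_def by blast
    with r(2)[OF x] show "\<exists>C\<in>\<C>. pm_ball (topspace X) e x (r / 2) \<subseteq> C"
      by blast
  qed (use r in simp)
  with r(1) show "\<exists>r. 0 < r \<and> {e \<in> CPM X. sup_dist X d e < ennreal r} \<subseteq> Lebesgue_CPM X \<C>"
    unfolding Lebesgue_CPM_def by (intro exI[of _ "r / 2"]) auto
qed

text \<open>
  Since \<open>d + c * \<rho> \<ge> c * \<rho>\<close>, a ball of radius \<open>c * r\<close> for the sum lies in the \<open>\<rho>\<close>-ball of radius
  \<open>r\<close>.
\<close>

lemma Lebesgue_CPM_add_scaled: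
  assumes d: "d \<in> CPM X" and \<rho>: "\<rho> \<in> CPM X" "Lebesgue_number (topspace X) \<C> \<rho> r" and c: "0 < c"
  shows "restrict (\<lambda>p. d p + c * \<rho> p) (topspace X \<times> topspace X) \<in> Lebesgue_CPM X \<C>"
    (is "?e \<in> _")
proof -
  have "Lebesgue_number (topspace X) \<C> ?e (c * r)"
    unfolding Lebesgue_number_def
  proof (intro conjI ballI)
    fix x assume x: "x \<in> topspace X"
    have "\<rho> (x, p) < r" if p: "p \<in> topspace X" "?e (x, p) < c * r" for p
    proof -
      have "0 \<le> d (x, p)"
        using d x p(1) unfolding CPM_def pseudometric_on_def PiE_def Pi_def by auto
      with p x have "c * \<rho> (x, p) < c * r" by simp
      with c show ?thesis by simp
    qed
    then have "pm_ball (topspace X) ?e x (c * r) \<subseteq> pm_ball (topspace X) \<rho> x r"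
      unfolding pm_ball_def by blast
    with \<rho>(2) x show "\<exists>C\<in>\<C>. pm_ball (topspace X) ?e x (c * r) \<subseteq> C"
      unfolding Lebesgue_number_def by (meson order_trans)
  qed (use \<rho>(2) c in \<open>simp add: Lebesgue_number_def\<close>)
  with CPM_add_scaled[OF d \<rho>(1), of c] c show ?thesis
    unfolding Lebesgue_CPM_def by auto
qed

theorem theorem1p1:
  fixes X :: "'a topology" and \<C> :: "'a set set"
  assumes "paracompact_space X"
    and "Hausdorff_space X"
    and "open_covering X \<C>"
  shows "openin (CPM_topology X) (Lebesgue_CPM X \<C>) \<and>
         CPM_topology X closure_of Lebesgue_CPM X \<C> = topspace (CPM_topology X)"
proof
  show "openin (CPM_topology X) (Lebesgue_CPM X \<C>)"
    by (rule openin_Lebesgue_CPM)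
  obtain \<rho> where \<rho>: "\<rho> \<in> CPM X" "Lebesgue_number (topspace X) \<C> \<rho> 1"
    and \<rho>_le: "\<And>x y. \<lbrakk>x \<in> topspace X; y \<in> topspace X\<rbrakk> \<Longrightarrow> \<rho> (x, y) \<le> 1"
    using exists_bounded_CPM_Lebesgue[OF assms] by metis
  have \<rho>_ge: "0 \<le> \<rho> (x, y)" if "x \<in> topspace X" "y \<in> topspace X" for x y
    using \<rho>(1) that unfolding CPM_def pseudometric_on_def PiE_def Pi_def by auto
  have "\<exists>e. e \<in> Lebesgue_CPM X \<C> \<and> e \<in> T" if T: "d \<in> T" "openin (CPM_topology X) T" for d T
  proof -
    obtain r :: real where r: "0 < r" "{e \<in> CPM X. sup_dist X d e < ennreal r} \<subseteq> T" and d: "d \<in> CPM X"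
      using T unfolding openin_CPM_topology by blast
    \<comment> \<open>As \<open>\<rho> \<le> 1\<close>, the factor \<open>r / 2\<close> keeps \<open>e\<close> strictly inside the ball of radius \<open>r\<close>.\<close>
    define e where "e = restrict (\<lambda>p. d p + r / 2 * \<rho> p) (topspace X \<times> topspace X)"
    have e: "e \<in> Lebesgue_CPM X \<C>"
      unfolding e_def by (rule Lebesgue_CPM_add_scaled[OF d \<rho>]) (use r(1) in simp)
    have "sup_dist X d e \<le> ennreal (r / 2)"
    proof (rule sup_dist_le)
      fix x y assume xy: "x \<in> topspace X" "y \<in> topspace X"
      then show "\<bar>d (x, y) - e (x, y)\<bar> \<le> r / 2"
        using \<rho>_le[OF xy] \<rho>_ge[OF xy] r(1) by (simp add: e_def abs_mult mult_left_le)
    qed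
    also have "\<dots> < ennreal r"
      using r(1) by (simp add: ennreal_less_iff)
    finally have "e \<in> T"
      using e r(2) unfolding Lebesgue_CPM_def by blast
    with e show ?thesis by blast
  qed
  then show "CPM_topology X closure_of Lebesgue_CPM X \<C> = topspace (CPM_topology X)"
    unfolding closure_of_def by auto
qed

end
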